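(* Consider $m\ge 1$ independent events, and for each event $\ell$ let $(c_\ell^*,s_\ell^* )$, with $s_\ell^*=(s_{\ell i}^* )_{i\in\Omega_\ell}$, be the unique optimal solution of its one-event Kelly problem; assume $c_\ell^*>0$ for every $\ell$. Let $x^*=(x^*_\gamma)_{\gamma\in\Gamma}$ be the optimal multibet book $$x_\gamma^*=\prod_{\ell:\,\gamma_\ell=0}c_\ell^*\ \prod_{\ell:\,\gamma_\ell\ne 0}s_{\ell,\gamma_\ell}^*\qquad(\gamma\in\Gamma).$$ Then a ticket $\gamma\in\Gamma$ is active in $x^*$ (i.e. $x^*_\gamma>0$) if and only if every selected leg is active in the corresponding one-event Kelly problem, i.e. $s_{\ell,\gamma_\ell}^*>0$ for every $\ell$ with $\gamma_\ell\neq0$. In particular, no ticket active in $x^*$ contains a leg $(\ell,\gamma_\ell)$, $\gamma_\ell\ne0$, with $s^*_{\ell,\gamma_\ell}=0$.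
   Context: Events. Event $\ell\in\{1,\dots,m\}$ has finite outcome set $\Omega_\ell=\{1,\dots,n_\ell\}$, probabilities $p_{\ell i}>0$ with $\sum_{i}p_{\ell i}=1$, and state prices $\pi_{\ell i}>0$. The realized outcomes $I_1,\dots,I_m$ are independent with $P(I_\ell=i)=p_{\ell i}$. Convention: $\log 0=-\infty$. One-event Kelly problem for event $\ell$: maximize $\sum_{i=1}^{n_\ell}p_{\ell i}\log\left(c+\frac{s_i}{\pi_{\ell i}}\right)$ over $c\ge 0$, $s_i\ge 0$ subject to $c+\sum_{i=1}^{n_\ell}s_i=1$. An outcome $i$ is active in this problem if $s_{\ell i}^*>0$ at the optimum. Tickets. A ticket is a vector $\gamma=(\gamma_1,\dots,\gamma_m)$ with $\gamma_\ell\in\{0\}\cup\Omega_\ell$; $\gamma_\ell=0$ means the ticket omits event $\ell$, and the selected legs of $\gamma$ are the pairs $(\ell,\gamma_\ell)$ with $\gamma_\ell\ne0$. $\Gamma$ is the set of all tickets, and $\pi_\gamma:=\prod_{\ell:\gamma_\ell\ne0}\pi_{\ell,\gamma_\ell}$ (empty product $=1$). The simultaneous multibet Kelly problem is to maximize $\mathbb{E}[\log W_x(I)]$, where $I=(I_1,\dots,I_m)$ and $W_x(I)=\sum_{\gamma:\ \gamma_\ell\in\{0,I_\ell\}\ \forall\ell}x_\gamma/\pi_\gamma$, over $x_\gamma\ge0$ with $\sum_{\gamma\in\Gamma}x_\gamma=1$. "The optimal multibet book" refers to the product vector $x^*$ displayed in the claim, which is a maximizer of this problem. *)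

theory Defs
  imports "HOL-Probability.Probability"
begin

text \<open>The real logarithm with the convention \<open>log 0 = -\<infinity>\<close>; note that the library's
  \<^const>\<open>ln\<close> on the reals has \<open>ln 0 = 0\<close>. Negative arguments do not occur below.\<close>

definition elog :: "real \<Rightarrow> ereal" where
  "elog w = (if w \<le> 0 then -\<infinity> else ereal (ln w))"

text \<open>The event has outcomes \<open>{1..n}\<close>; a pair of cash \<open>c\<close> and stakes \<open>s\<close> only matters
  through the values of \<open>s\<close> on \<open>{1..n}\<close>, so uniqueness of an optimum is understood on that set.\<close>

definition kelly_feasible :: "nat \<Rightarrow> real \<Rightarrow> (nat \<Rightarrow> real) \<Rightarrow> bool" where
  "kelly_feasible n c s \<longleftrightarrow> c \<ge> 0 \<and> (\<forall>i\<in>{1..n}. s i \<ge> 0) \<and> c + (\<Sum>i\<in>{1..n}. s i) = 1"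

definition kelly_objective ::
  "nat \<Rightarrow> (nat \<Rightarrow> real) \<Rightarrow> (nat \<Rightarrow> real) \<Rightarrow> real \<Rightarrow> (nat \<Rightarrow> real) \<Rightarrow> ereal" where
  "kelly_objective n p \<pi> c s = (\<Sum>i\<in>{1..n}. ereal (p i) * elog (c + s i / \<pi> i))"

definition kelly_optimal ::
  "nat \<Rightarrow> (nat \<Rightarrow> real) \<Rightarrow> (nat \<Rightarrow> real) \<Rightarrow> real \<Rightarrow> (nat \<Rightarrow> real) \<Rightarrow> bool" where
  "kelly_optimal n p \<pi> c s \<longleftrightarrow> kelly_feasible n c s \<and>
     (\<forall>c' s'. kelly_feasible n c' s' \<longrightarrow> kelly_objective n p \<pi> c' s' \<le> kelly_objective n p \<pi> c s)"

definition kelly_unique_optimal ::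
  "nat \<Rightarrow> (nat \<Rightarrow> real) \<Rightarrow> (nat \<Rightarrow> real) \<Rightarrow> real \<Rightarrow> (nat \<Rightarrow> real) \<Rightarrow> bool" where
  "kelly_unique_optimal n p \<pi> c s \<longleftrightarrow> kelly_optimal n p \<pi> c s \<and>
     (\<forall>c' s'. kelly_optimal n p \<pi> c' s' \<longrightarrow> c' = c \<and> (\<forall>i\<in>{1..n}. s' i = s i))"

definition outcome_active :: "(nat \<Rightarrow> real) \<Rightarrow> nat \<Rightarrow> bool" where
  "outcome_active s i \<longleftrightarrow> s i > 0"

text \<open>The value \<open>0\<close> of a ticket at \<open>l\<close> means that event \<open>l\<close> is omitted. Extensional functions
  represent vectors indexed by \<open>{1..m}\<close>, so that each ticket is counted once.\<close>

definition tickets :: "nat \<Rightarrow> (nat \<Rightarrow> nat) \<Rightarrow> (nat \<Rightarrow> nat) set" where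
  "tickets m n = (\<Pi>\<^sub>E l\<in>{1..m}. {0} \<union> {1..n l})"

definition selected :: "nat \<Rightarrow> (nat \<Rightarrow> nat) \<Rightarrow> nat set" where
  "selected m \<gamma> = {l\<in>{1..m}. \<gamma> l \<noteq> 0}"

definition ticket_price :: "nat \<Rightarrow> (nat \<Rightarrow> nat \<Rightarrow> real) \<Rightarrow> (nat \<Rightarrow> nat) \<Rightarrow> real" where
  "ticket_price m \<pi> \<gamma> = (\<Prod>l\<in>selected m \<gamma>. \<pi> l (\<gamma> l))"

definition wealth ::
  "nat \<Rightarrow> (nat \<Rightarrow> nat) \<Rightarrow> (nat \<Rightarrow> nat \<Rightarrow> real) \<Rightarrow> ((nat \<Rightarrow> nat) \<Rightarrow> real) \<Rightarrow> (nat \<Rightarrow> nat) \<Rightarrow> real" where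
  "wealth m n \<pi> x \<omega> =
     (\<Sum>\<gamma>\<in>{\<gamma>\<in>tickets m n. \<forall>l\<in>{1..m}. \<gamma> l \<in> {0, \<omega> l}}. x \<gamma> / ticket_price m \<pi> \<gamma>)"

text \<open>Expectation of an extended-real random variable as the difference of the integrals of its
  positive and negative parts; \<^const>\<open>e2ennreal\<close> maps negative values to \<open>0\<close>. The Bochner
  integral cannot be used because \<open>elog\<close> may take the value \<open>-\<infinity>\<close>. The wealth below is bounded,
  so the positive part always has finite integral.\<close>

definition ext_expectation :: "'a measure \<Rightarrow> ('a \<Rightarrow> ereal) \<Rightarrow> ereal" where
  "ext_expectation M f =
     enn2ereal (\<integral>\<^sup>+ z. e2ennreal (f z) \<partial>M) - enn2ereal (\<integral>\<^sup>+ z. e2ennreal (- f z) \<partial>M)"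

definition multibet_feasible :: "nat \<Rightarrow> (nat \<Rightarrow> nat) \<Rightarrow> ((nat \<Rightarrow> nat) \<Rightarrow> real) \<Rightarrow> bool" where
  "multibet_feasible m n x \<longleftrightarrow> (\<forall>\<gamma>\<in>tickets m n. x \<gamma> \<ge> 0) \<and> (\<Sum>\<gamma>\<in>tickets m n. x \<gamma>) = 1"

definition multibet_objective ::
  "'a measure \<Rightarrow> (nat \<Rightarrow> 'a \<Rightarrow> nat) \<Rightarrow> nat \<Rightarrow> (nat \<Rightarrow> nat) \<Rightarrow> (nat \<Rightarrow> nat \<Rightarrow> real) \<Rightarrow>
   ((nat \<Rightarrow> nat) \<Rightarrow> real) \<Rightarrow> ereal" where
  "multibet_objective M I m n \<pi> x = ext_expectation M (\<lambda>z. elog (wealth m n \<pi> x (\<lambda>l. I l z)))"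

definition multibet_optimal ::
  "'a measure \<Rightarrow> (nat \<Rightarrow> 'a \<Rightarrow> nat) \<Rightarrow> nat \<Rightarrow> (nat \<Rightarrow> nat) \<Rightarrow> (nat \<Rightarrow> nat \<Rightarrow> real) \<Rightarrow>
   ((nat \<Rightarrow> nat) \<Rightarrow> real) \<Rightarrow> bool" where
  "multibet_optimal M I m n \<pi> x \<longleftrightarrow> multibet_feasible m n x \<and>
     (\<forall>y. multibet_feasible m n y \<longrightarrow>
        multibet_objective M I m n \<pi> y \<le> multibet_objective M I m n \<pi> x)"

definition product_book ::
  "nat \<Rightarrow> (nat \<Rightarrow> real) \<Rightarrow> (nat \<Rightarrow> nat \<Rightarrow> real) \<Rightarrow> (nat \<Rightarrow> nat) \<Rightarrow> real" where
  "product_book m c s \<gamma> =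
     (\<Prod>l\<in>{l\<in>{1..m}. \<gamma> l = 0}. c l) * (\<Prod>l\<in>selected m \<gamma>. s l (\<gamma> l))"

definition ticket_active :: "((nat \<Rightarrow> nat) \<Rightarrow> real) \<Rightarrow> (nat \<Rightarrow> nat) \<Rightarrow> bool" where
  "ticket_active x \<gamma> \<longleftrightarrow> x \<gamma> > 0"

end

theory Submission
  imports Defs
begin

text \<open>Once the optimality of the product book is known, the statement about active tickets is only
  that a product of nonnegative factors is positive iff all its factors are, where the cash factors
  are positive by assumption. So the content is the optimality of the product book.

  This is a duality argument in which the optimal wealth is the numeraire. In one event, write
  \<open>V i = c + s i / \<pi> i\<close> for the optimal wealth in outcome \<open>i\<close>. Moving a small fraction of the
  optimal portfolio into a single instrument (cash, or a bet on one outcome) cannot raise the expected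
  log wealth, and the derivative of this perturbation says that the payout of each instrument,
  divided by \<open>V\<close>, has expectation at most \<open>1\<close> (\<open>kelly_optimal_instrument_bound\<close>).

  A ticket pays the product over the events of the payouts of one instrument each, and the product
  book has as wealth the product of the one-event wealths (\<open>wealth_product_book\<close>). By independence
  the expected ratio of a ticket's payout to the wealth of the product book is a product of one-event
  expectations, hence at most \<open>1\<close>; averaging over tickets, \<open>E[W\<^sub>y / W\<^sub>x] \<le> 1\<close> for every feasible book
  \<open>y\<close> (\<open>expected_wealth_ratio_le_1\<close>). Finally \<open>log W\<^sub>y \<le> log W\<^sub>x + W\<^sub>y / W\<^sub>x - 1\<close> pointwise, and
  taking expectations gives \<open>E[log W\<^sub>y] \<le> E[log W\<^sub>x]\<close> (\<open>product_book_optimal\<close>).\<close>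


section \<open>First-order condition for the one-event problem\<close>

text \<open>Instrument \<open>0\<close> is cash and instrument \<open>k > 0\<close> is the unit stake on outcome \<open>k\<close>, matching the
  coding of the entries of a ticket, so that a ticket pays the product of the payouts of its
  entries.\<close>

definition payout :: "(nat \<Rightarrow> real) \<Rightarrow> nat \<Rightarrow> nat \<Rightarrow> real" where
  "payout \<pi> k i = (if k = 0 then 1 else if k = i then 1 / \<pi> k else 0)"

definition holding :: "real \<Rightarrow> (nat \<Rightarrow> real) \<Rightarrow> nat \<Rightarrow> real" where
  "holding c s k = (if k = 0 then c else s k)"

lemma payout_nonneg: "(k = 0 \<or> \<pi> k > 0) \<Longrightarrow> payout \<pi> k i \<ge> 0"
  by (auto simp: payout_def)

lemma sum_outcomes_with_0:
  fixes f :: "nat \<Rightarrow> real"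
  shows "(\<Sum>k\<in>{0} \<union> {1..n}. f k) = f 0 + (\<Sum>k\<in>{1..n}. f k)"
  by (subst sum.union_disjoint) auto

lemma sum_holding: "(\<Sum>k\<in>{0} \<union> {1..n}. holding c s k) = c + (\<Sum>k\<in>{1..n}. s k)"
  unfolding sum_outcomes_with_0 by (simp add: holding_def)

lemma sum_holding_payout:
  assumes "i \<in> {1..n}"
  shows "(\<Sum>k\<in>{0} \<union> {1..n}. holding c s k * payout \<pi> k i) = c + s i / \<pi> i"
proof -
  have "(\<Sum>k\<in>{1..n}. holding c s k * payout \<pi> k i) = (\<Sum>k\<in>{1..n}. if k = i then s i / \<pi> i else 0)"
    by (intro sum.cong) (auto simp: holding_def payout_def)
  also have "\<dots> = s i / \<pi> i"
    using assms by simp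
  finally show ?thesis
    unfolding sum_outcomes_with_0 by (simp add: holding_def payout_def)
qed

lemma kelly_objective_eq_sum_ln:
  assumes "\<And>i. i \<in> {1..n} \<Longrightarrow> c + s i / \<pi> i > 0"
  shows "kelly_objective n p \<pi> c s = ereal (\<Sum>i\<in>{1..n}. p i * ln (c + s i / \<pi> i))"
proof -
  have "kelly_objective n p \<pi> c s = (\<Sum>i\<in>{1..n}. ereal (p i * ln (c + s i / \<pi> i)))"
    unfolding kelly_objective_def
  proof (intro sum.cong refl)
    fix i assume "i \<in> {1..n}"
    from assms[OF this] show "ereal (p i) * elog (c + s i / \<pi> i) = ereal (p i * ln (c + s i / \<pi> i))"
      by (simp add: elog_def)
  qed
  then show ?thesis by simp
qed

lemma kelly_optimal_value_pos:
  assumes "kelly_optimal n p \<pi> c s" "c > 0" "i \<in> {1..n}" "\<pi> i > 0"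
  shows "c + s i / \<pi> i > 0"
  using assms unfolding kelly_optimal_def kelly_feasible_def
  by (intro add_pos_nonneg divide_nonneg_pos) auto

text \<open>Along the segment from the optimum to the competing portfolio the expected log wealth is
  a differentiable function with derivative \<open>(\<Sum>i. p i * W' i / W i) - 1\<close> at the optimum; a positive
  derivative would give a strictly better feasible portfolio nearby.\<close>

lemma kelly_optimal_ratio_bound:
  assumes opt: "kelly_optimal n p \<pi> c s"
    and pos: "\<And>i. i \<in> {1..n} \<Longrightarrow> c + s i / \<pi> i > 0"
    and \<pi>: "\<And>i. i \<in> {1..n} \<Longrightarrow> \<pi> i > 0"
    and p1: "(\<Sum>i\<in>{1..n}. p i) = 1"
    and feas': "kelly_feasible n c' s'"
  shows "(\<Sum>i\<in>{1..n}. p i * ((c' + s' i / \<pi> i) / (c + s i / \<pi> i))) \<le> 1"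
proof (rule ccontr)
  define W where "W i = c + s i / \<pi> i" for i
  define W' where "W' i = c' + s' i / \<pi> i" for i
  define f where "f t = (\<Sum>i\<in>{1..n}. p i * ln (W i + t * (W' i - W i)))" for t
  define D where "D = (\<Sum>i\<in>{1..n}. p i * (W' i / W i)) - 1"
  assume "\<not> ?thesis"
  then have "D > 0" by (simp add: D_def W_def W'_def)
  have Wpos: "W i > 0" if "i \<in> {1..n}" for i
    using pos[OF that] by (simp add: W_def)
  have W'_nonneg: "W' i \<ge> 0" if "i \<in> {1..n}" for i
    using feas' \<pi>[OF that] that by (auto simp: W'_def kelly_feasible_def intro!: add_nonneg_nonneg)
  have feas: "kelly_feasible n c s"
    using opt by (simp add: kelly_optimal_def)
  have "(f has_real_derivative (\<Sum>i\<in>{1..n}. p i * ((W' i - W i) / W i))) (at 0)"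
    unfolding f_def
    by (auto intro!: derivative_eq_intros simp: Wpos mult.commute)
  also have "(\<Sum>i\<in>{1..n}. p i * ((W' i - W i) / W i)) = (\<Sum>i\<in>{1..n}. p i * (W' i / W i) - p i)"
  proof (intro sum.cong refl)
    fix i assume "i \<in> {1..n}"
    from Wpos[OF this] show "p i * ((W' i - W i) / W i) = p i * (W' i / W i) - p i"
      by (simp add: field_simps)
  qed
  also have "\<dots> = D"
    using p1 by (simp add: D_def sum_subtractf)
  finally have "(f has_real_derivative D) (at 0)" .
  from DERIV_pos_inc_right[OF this \<open>D > 0\<close>]
  obtain d where d: "d > 0" "\<And>h. 0 < h \<Longrightarrow> h < d \<Longrightarrow> f 0 < f h"
    by auto
  \<comment> \<open>Stopping short of \<open>t = 1\<close> keeps the wealth positive where the competing wealth is \<open>0\<close>.\<close>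
  define t where "t = min (1/2) (d/2)"
  have t: "0 < t" "t < 1" "t < d"
    using d(1) by (auto simp: t_def)
  define ct where "ct = (1 - t) * c + t * c'"
  define st where "st i = (1 - t) * s i + t * s' i" for i
  have Wt: "ct + st i / \<pi> i = W i + t * (W' i - W i)" for i
    by (simp add: ct_def st_def W_def W'_def algebra_simps add_divide_distrib diff_divide_distrib)
  have Wt_pos: "ct + st i / \<pi> i > 0" if "i \<in> {1..n}" for i
  proof -
    have "0 < (1 - t) * W i + t * W' i"
      using Wpos[OF that] W'_nonneg[OF that] t by (intro add_pos_nonneg mult_pos_pos) auto
    then show ?thesis unfolding Wt by (simp add: algebra_simps)
  qed
  have "kelly_feasible n ct st"
  proof -
    have "ct + (\<Sum>i\<in>{1..n}. st i) = (1 - t) * (c + (\<Sum>i\<in>{1..n}. s i)) + t * (c' + (\<Sum>i\<in>{1..n}. s' i))"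
      by (simp add: ct_def st_def sum.distrib sum_distrib_left distrib_left)
    also have "\<dots> = 1"
      using feas feas' by (simp add: kelly_feasible_def)
    finally show ?thesis
      using feas feas' t by (auto simp: kelly_feasible_def ct_def st_def)
  qed
  then have "kelly_objective n p \<pi> ct st \<le> kelly_objective n p \<pi> c s"
    using opt by (simp add: kelly_optimal_def)
  moreover have "kelly_objective n p \<pi> ct st = ereal (f t)"
    using kelly_objective_eq_sum_ln[OF Wt_pos, where p = p] by (simp add: f_def Wt)
  moreover have "kelly_objective n p \<pi> c s = ereal (f 0)"
    using kelly_objective_eq_sum_ln[OF pos, where p = p] by (simp add: f_def W_def)
  ultimately have "f t \<le> f 0" by simp
  with d(2)[OF t(1,3)] show False by simp
qed

text \<open>The instruments are the vertices of the feasible simplex; being linear in the competing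
  portfolio, the bound is needed only there.\<close>

lemma kelly_optimal_instrument_bound:
  assumes opt: "kelly_optimal n p \<pi> c s"
    and pos: "\<And>i. i \<in> {1..n} \<Longrightarrow> c + s i / \<pi> i > 0"
    and \<pi>: "\<And>i. i \<in> {1..n} \<Longrightarrow> \<pi> i > 0"
    and p1: "(\<Sum>i\<in>{1..n}. p i) = 1"
    and k: "k \<in> {0} \<union> {1..n}"
  shows "(\<Sum>i\<in>{1..n}. p i * (payout \<pi> k i / (c + s i / \<pi> i))) \<le> 1"
proof -
  define c' :: real where "c' = (if k = 0 then 1 else 0)"
  define s' :: "nat \<Rightarrow> real" where "s' i = (if i = k then 1 - c' else 0)" for i
  have "kelly_feasible n c' s'"
    using k by (auto simp: kelly_feasible_def c'_def s'_def)
  moreover have "c' + s' i / \<pi> i = payout \<pi> k i" if "i \<in> {1..n}" for i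
    using that by (auto simp: c'_def s'_def payout_def)
  ultimately show ?thesis
    using kelly_optimal_ratio_bound[OF opt pos \<pi> p1, of c' s'] by simp
qed


section \<open>Books and their wealth\<close>

lemma finite_tickets: "finite (tickets m n)"
  unfolding tickets_def by (intro finite_PiE) auto

lemma ticket_entry: "\<gamma> \<in> tickets m n \<Longrightarrow> l \<in> {1..m} \<Longrightarrow> \<gamma> l \<in> {0} \<union> {1..n l}"
  unfolding tickets_def by (rule PiE_mem)

lemma product_book_eq_prod: "product_book m c s \<gamma> = (\<Prod>l\<in>{1..m}. holding (c l) (s l) (\<gamma> l))"
proof -
  have "{1..m} \<inter> {l. \<gamma> l = 0} = {l\<in>{1..m}. \<gamma> l = 0}" "{1..m} \<inter> - {l. \<gamma> l = 0} = selected m \<gamma>"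
    by (auto simp: selected_def)
  then show ?thesis
    unfolding product_book_def holding_def by (simp add: prod.If_cases)
qed

text \<open>Letting incompatible tickets pay \<open>0\<close> removes the outcome-dependent index set from the wealth
  and makes every ticket a product over the events, as independence requires.\<close>

lemma ticket_payout:
  "(if \<forall>l\<in>{1..m}. \<gamma> l \<in> {0, \<omega> l} then 1 / ticket_price m \<pi> \<gamma> else 0)
     = (\<Prod>l\<in>{1..m}. payout (\<pi> l) (\<gamma> l) (\<omega> l))"
proof (cases "\<forall>l\<in>{1..m}. \<gamma> l \<in> {0, \<omega> l}")
  case True
  have "(\<Prod>l\<in>{1..m}. payout (\<pi> l) (\<gamma> l) (\<omega> l)) = (\<Prod>l\<in>{1..m}. if \<gamma> l = 0 then 1 else 1 / \<pi> l (\<gamma> l))"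
  proof (intro prod.cong refl)
    fix l assume "l \<in> {1..m}"
    with True have "\<gamma> l \<in> {0, \<omega> l}" by blast
    then show "payout (\<pi> l) (\<gamma> l) (\<omega> l) = (if \<gamma> l = 0 then 1 else 1 / \<pi> l (\<gamma> l))"
      by (auto simp: payout_def)
  qed
  also have "\<dots> = (\<Prod>l\<in>{1..m} \<inter> - {l. \<gamma> l = 0}. 1 / \<pi> l (\<gamma> l))"
    by (simp add: prod.If_cases)
  also have "{1..m} \<inter> - {l. \<gamma> l = 0} = selected m \<gamma>"
    by (auto simp: selected_def)
  finally show ?thesis
    using True by (simp add: ticket_price_def prod_dividef)
next
  case False
  then obtain l where "l \<in> {1..m}" "payout (\<pi> l) (\<gamma> l) (\<omega> l) = 0"
    by (auto simp: payout_def)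
  then have "(\<Prod>l\<in>{1..m}. payout (\<pi> l) (\<gamma> l) (\<omega> l)) = 0"
    by (intro prod_zero) auto
  then show ?thesis
    unfolding if_not_P[OF False] by simp
qed

lemma wealth_eq_sum_payout:
  "wealth m n \<pi> x \<omega> = (\<Sum>\<gamma>\<in>tickets m n. x \<gamma> * (\<Prod>l\<in>{1..m}. payout (\<pi> l) (\<gamma> l) (\<omega> l)))"
proof -
  have "wealth m n \<pi> x \<omega> =
      (\<Sum>\<gamma>\<in>tickets m n. if \<forall>l\<in>{1..m}. \<gamma> l \<in> {0, \<omega> l} then x \<gamma> / ticket_price m \<pi> \<gamma> else 0)"
    unfolding wealth_def by (rule sum.inter_filter[OF finite_tickets])
  also have "\<dots> = (\<Sum>\<gamma>\<in>tickets m n. x \<gamma> * (\<Prod>l\<in>{1..m}. payout (\<pi> l) (\<gamma> l) (\<omega> l)))"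
    unfolding ticket_payout[symmetric] by (intro sum.cong) auto
  finally show ?thesis .
qed

text \<open>Expanding the product over the events of the one-event sums yields one term per ticket.\<close>

lemma wealth_product_book:
  assumes "\<And>l. l \<in> {1..m} \<Longrightarrow> \<omega> l \<in> {1..n l}"
    and "\<And>\<gamma>. \<gamma> \<in> tickets m n \<Longrightarrow> x \<gamma> = product_book m c s \<gamma>"
  shows "wealth m n \<pi> x \<omega> = (\<Prod>l\<in>{1..m}. c l + s l (\<omega> l) / \<pi> l (\<omega> l))"
proof -
  have "wealth m n \<pi> x \<omega> = (\<Sum>\<gamma>\<in>tickets m n.
      \<Prod>l\<in>{1..m}. holding (c l) (s l) (\<gamma> l) * payout (\<pi> l) (\<gamma> l) (\<omega> l))"
    unfolding wealth_eq_sum_payout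
    by (intro sum.cong refl) (simp add: assms(2) product_book_eq_prod prod.distrib)
  also have "\<dots> = (\<Prod>l\<in>{1..m}. \<Sum>k\<in>{0} \<union> {1..n l}. holding (c l) (s l) k * payout (\<pi> l) k (\<omega> l))"
    unfolding tickets_def by (rule prod_sum_PiE[symmetric]) auto
  also have "\<dots> = (\<Prod>l\<in>{1..m}. c l + s l (\<omega> l) / \<pi> l (\<omega> l))"
    by (intro prod.cong refl sum_holding_payout assms(1))
  finally show ?thesis .
qed

lemma holding_nonneg:
  "kelly_feasible n c s \<Longrightarrow> k \<in> {0} \<union> {1..n} \<Longrightarrow> holding c s k \<ge> 0"
  by (auto simp: kelly_feasible_def holding_def)

lemma product_book_feasible:
  assumes feas: "\<And>l. l \<in> {1..m} \<Longrightarrow> kelly_feasible (n l) (c l) (s l)"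
    and x: "\<And>\<gamma>. \<gamma> \<in> tickets m n \<Longrightarrow> x \<gamma> = product_book m c s \<gamma>"
  shows "multibet_feasible m n x"
  unfolding multibet_feasible_def
proof (intro conjI ballI)
  fix \<gamma> assume "\<gamma> \<in> tickets m n"
  then show "x \<gamma> \<ge> 0"
    unfolding x[OF \<open>\<gamma> \<in> tickets m n\<close>] product_book_eq_prod
    by (intro prod_nonneg ballI holding_nonneg[OF feas] ticket_entry)
next
  have "(\<Sum>\<gamma>\<in>tickets m n. x \<gamma>) = (\<Sum>\<gamma>\<in>tickets m n. \<Prod>l\<in>{1..m}. holding (c l) (s l) (\<gamma> l))"
    by (intro sum.cong refl) (simp add: x product_book_eq_prod)
  also have "\<dots> = (\<Prod>l\<in>{1..m}. \<Sum>k\<in>{0} \<union> {1..n l}. holding (c l) (s l) k)"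
    unfolding tickets_def by (rule prod_sum_PiE[symmetric]) auto
  also have "\<dots> = 1"
  proof (rule prod.neutral, rule ballI)
    fix l assume "l \<in> {1..m}"
    then show "(\<Sum>k\<in>{0} \<union> {1..n l}. holding (c l) (s l) k) = 1"
      unfolding sum_holding using feas by (simp add: kelly_feasible_def)
  qed
  finally show "(\<Sum>\<gamma>\<in>tickets m n. x \<gamma>) = 1" .
qed

lemma product_book_pos_iff:
  assumes feas: "\<And>l. l \<in> {1..m} \<Longrightarrow> kelly_feasible (n l) (c l) (s l)"
    and c: "\<And>l. l \<in> {1..m} \<Longrightarrow> c l > 0"
    and \<gamma>: "\<gamma> \<in> tickets m n"
  shows "product_book m c s \<gamma> > 0 \<longleftrightarrow> (\<forall>l\<in>selected m \<gamma>. s l (\<gamma> l) > 0)"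
proof -
  have nonneg: "holding (c l) (s l) (\<gamma> l) \<ge> 0" if "l \<in> {1..m}" for l
    using that by (intro holding_nonneg[OF feas] ticket_entry[OF \<gamma>])
  have "product_book m c s \<gamma> > 0 \<longleftrightarrow> (\<forall>l\<in>{1..m}. holding (c l) (s l) (\<gamma> l) > 0)"
  proof
    assume pos: "product_book m c s \<gamma> > 0"
    show "\<forall>l\<in>{1..m}. holding (c l) (s l) (\<gamma> l) > 0"
    proof
      fix l assume l: "l \<in> {1..m}"
      have "holding (c l) (s l) (\<gamma> l) \<noteq> 0"
        using pos l unfolding product_book_eq_prod by (metis finite_atLeastAtMost less_irrefl prod_zero)
      with nonneg[OF l] show "holding (c l) (s l) (\<gamma> l) > 0" by simp
    qed
  next
    assume "\<forall>l\<in>{1..m}. holding (c l) (s l) (\<gamma> l) > 0"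
    then show "product_book m c s \<gamma> > 0"
      unfolding product_book_eq_prod by (intro prod_pos) blast
  qed
  also have "\<dots> \<longleftrightarrow> (\<forall>l\<in>selected m \<gamma>. s l (\<gamma> l) > 0)"
    using c by (auto simp: holding_def selected_def)
  finally show ?thesis .
qed


section \<open>Expectations\<close>

text \<open>The nonnegative integral is monotone on arbitrary functions, and subtraction on the
  extended reals is monotone even where it involves \<open>\<infinity>\<close>. This is what lets a log wealth
  that is \<open>-\<infinity>\<close> with positive probability be compared with a finite one without a case split.\<close>

lemma ext_expectation_mono:
  assumes "\<And>z. z \<in> space M \<Longrightarrow> f z \<le> g z"
  shows "ext_expectation M f \<le> ext_expectation M g"
  unfolding ext_expectation_def
proof (intro ereal_minus_mono)
  show "enn2ereal (\<integral>\<^sup>+ z. e2ennreal (f z) \<partial>M) \<le> enn2ereal (\<integral>\<^sup>+ z. e2ennreal (g z) \<partial>M)"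
    unfolding less_eq_ennreal.rep_eq[symmetric]
    by (intro nn_integral_mono e2ennreal_mono assms)
  show "enn2ereal (\<integral>\<^sup>+ z. e2ennreal (- g z) \<partial>M) \<le> enn2ereal (\<integral>\<^sup>+ z. e2ennreal (- f z) \<partial>M)"
    unfolding less_eq_ennreal.rep_eq[symmetric]
    by (intro nn_integral_mono e2ennreal_mono) (simp add: assms)
qed

lemma ext_expectation_cong:
  assumes "\<And>z. z \<in> space M \<Longrightarrow> f z = g z"
  shows "ext_expectation M f = ext_expectation M g"
  by (intro antisym ext_expectation_mono) (simp_all add: assms)

lemma ext_expectation_ereal:
  fixes g :: "'a \<Rightarrow> real"
  assumes "integrable M g"
  shows "ext_expectation M (\<lambda>z. ereal (g z)) = ereal (integral\<^sup>L M g)"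
proof -
  have "(\<integral>\<^sup>+ z. ennreal (g z) \<partial>M) \<noteq> \<infinity>" "(\<integral>\<^sup>+ z. ennreal (- g z) \<partial>M) \<noteq> \<infinity>"
    using assms by (auto simp: real_integrable_def)
  then show ?thesis
    unfolding ext_expectation_def real_lebesgue_integral_def[OF assms]
    by (cases "\<integral>\<^sup>+ z. ennreal (g z) \<partial>M"; cases "\<integral>\<^sup>+ z. ennreal (- g z) \<partial>M") auto
qed

lemma (in prob_space) finite_valued_expectation:
  fixes X :: "'a \<Rightarrow> 'b" and h :: "'b \<Rightarrow> real"
  assumes X: "X \<in> measurable M (count_space A)" and A: "finite A"
  shows "integrable M (\<lambda>z. h (X z))"
    and "expectation (\<lambda>z. h (X z)) = (\<Sum>i\<in>A. prob {z \<in> space M. X z = i} * h i)"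
proof -
  have [measurable]: "{z \<in> space M. X z = i} \<in> events" if "i \<in> A" for i
  proof -
    have "X -` {i} \<inter> space M \<in> events"
      using that by (intro measurable_sets[OF X]) auto
    also have "X -` {i} \<inter> space M = {z \<in> space M. X z = i}" by auto
    finally show ?thesis .
  qed
  have decomp: "h (X z) = (\<Sum>i\<in>A. indicator {z \<in> space M. X z = i} z * h i)" if "z \<in> space M" for z
  proof -
    have "X z \<in> A"
      using measurable_space[OF X that] by simp
    have "(\<Sum>i\<in>A. indicator {z \<in> space M. X z = i} z * h i) = (\<Sum>i\<in>A. if X z = i then h i else 0)"
      using that by (intro sum.cong) auto
    also have "\<dots> = h (X z)"
      using A \<open>X z \<in> A\<close> by simp
    finally show ?thesis ..
  qed
  have int: "integrable M (\<lambda>z. indicator {z \<in> space M. X z = i} z * h i)" if "i \<in> A" for i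
    using that by (intro integrable_mult_left integrable_real_indicator) (auto simp: less_top[symmetric])
  have "integrable M (\<lambda>z. h (X z)) \<longleftrightarrow>
      integrable M (\<lambda>z. \<Sum>i\<in>A. indicator {z \<in> space M. X z = i} z * h i)"
    by (rule Bochner_Integration.integrable_cong[OF refl decomp])
  with int show "integrable M (\<lambda>z. h (X z))" by simp
  have "expectation (\<lambda>z. h (X z)) = expectation (\<lambda>z. \<Sum>i\<in>A. indicator {z \<in> space M. X z = i} z * h i)"
    by (rule Bochner_Integration.integral_cong[OF refl decomp])
  also have "\<dots> = (\<Sum>i\<in>A. expectation (\<lambda>z. indicator {z \<in> space M. X z = i} z * h i))"
    by (rule Bochner_Integration.integral_sum[OF int])
  also have "\<dots> = (\<Sum>i\<in>A. prob {z \<in> space M. X z = i} * h i)"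
  proof (intro sum.cong refl)
    fix i assume "i \<in> A"
    have "expectation (indicator {z \<in> space M. X z = i}) = prob {z \<in> space M. X z = i}"
      using \<open>i \<in> A\<close> by (simp add: Int_absorb2 Collect_restrict)
    then show "expectation (\<lambda>z. indicator {z \<in> space M. X z = i} z * h i) = prob {z \<in> space M. X z = i} * h i"
      by simp
  qed
  finally show "expectation (\<lambda>z. h (X z)) = (\<Sum>i\<in>A. prob {z \<in> space M. X z = i} * h i)" .
qed

lemma (in prob_space) indep_vars_finite_valued_prod:
  fixes h :: "'i \<Rightarrow> 'b \<Rightarrow> real"
  assumes ind: "indep_vars (\<lambda>l. count_space (A l)) X L"
    and L: "finite L" and A: "\<And>l. l \<in> L \<Longrightarrow> finite (A l)"
  shows "integrable M (\<lambda>z. \<Prod>l\<in>L. h l (X l z))"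
    and "expectation (\<lambda>z. \<Prod>l\<in>L. h l (X l z)) =
      (\<Prod>l\<in>L. \<Sum>i\<in>A l. prob {z \<in> space M. X l z = i} * h l i)"
proof -
  have X: "X l \<in> measurable M (count_space (A l))" if "l \<in> L" for l
    using ind that by (auto simp: indep_vars_def)
  have ind': "indep_vars (\<lambda>_. borel) (\<lambda>l z. h l (X l z)) L"
    by (rule indep_vars_compose2[OF ind]) simp
  have int: "integrable M (\<lambda>z. h l (X l z))" if "l \<in> L" for l
    by (rule finite_valued_expectation(1)[OF X[OF that] A[OF that]])
  show "integrable M (\<lambda>z. \<Prod>l\<in>L. h l (X l z))"
    by (rule indep_vars_integrable[OF L ind' int])
  have "expectation (\<lambda>z. \<Prod>l\<in>L. h l (X l z)) = (\<Prod>l\<in>L. expectation (\<lambda>z. h l (X l z)))"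
    by (rule indep_vars_lebesgue_integral[OF L ind' int])
  also have "\<dots> = (\<Prod>l\<in>L. \<Sum>i\<in>A l. prob {z \<in> space M. X l z = i} * h l i)"
    by (intro prod.cong refl finite_valued_expectation(2) X A)
  finally show "expectation (\<lambda>z. \<Prod>l\<in>L. h l (X l z)) =
      (\<Prod>l\<in>L. \<Sum>i\<in>A l. prob {z \<in> space M. X l z = i} * h l i)" .
qed


section \<open>Optimality of the product book\<close>

text \<open>The ratio is linear in \<open>y\<close>, and for a single ticket it is a product of functions of the
  independent outcomes, each with expectation at most \<open>1\<close>.\<close>

lemma (in prob_space) expected_wealth_ratio_le_1:
  fixes V :: "nat \<Rightarrow> nat \<Rightarrow> real"
  assumes ind: "indep_vars (\<lambda>l. count_space {1..n l}) I {1..m}"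
    and V: "\<And>l i. l \<in> {1..m} \<Longrightarrow> i \<in> {1..n l} \<Longrightarrow> V l i > 0"
    and \<pi>: "\<And>l i. l \<in> {1..m} \<Longrightarrow> i \<in> {1..n l} \<Longrightarrow> \<pi> l i > 0"
    and bound: "\<And>l k. l \<in> {1..m} \<Longrightarrow> k \<in> {0} \<union> {1..n l} \<Longrightarrow>
        (\<Sum>i\<in>{1..n l}. prob {z \<in> space M. I l z = i} * (payout (\<pi> l) k i / V l i)) \<le> 1"
    and y: "multibet_feasible m n y"
  shows "integrable M (\<lambda>z. wealth m n \<pi> y (\<lambda>l. I l z) / (\<Prod>l\<in>{1..m}. V l (I l z)))"
    and "expectation (\<lambda>z. wealth m n \<pi> y (\<lambda>l. I l z) / (\<Prod>l\<in>{1..m}. V l (I l z))) \<le> 1"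
proof -
  define h where "h \<gamma> l i = payout (\<pi> l) (\<gamma> l) i / V l i" for \<gamma> l i
  have ratio: "wealth m n \<pi> y (\<lambda>l. I l z) / (\<Prod>l\<in>{1..m}. V l (I l z)) =
      (\<Sum>\<gamma>\<in>tickets m n. y \<gamma> * (\<Prod>l\<in>{1..m}. h \<gamma> l (I l z)))" for z
    unfolding wealth_eq_sum_payout h_def by (simp add: sum_divide_distrib prod_dividef)
  have int: "integrable M (\<lambda>z. \<Prod>l\<in>{1..m}. h \<gamma> l (I l z))" for \<gamma>
    by (rule indep_vars_finite_valued_prod(1)[OF ind]) auto
  then show "integrable M (\<lambda>z. wealth m n \<pi> y (\<lambda>l. I l z) / (\<Prod>l\<in>{1..m}. V l (I l z)))"
    unfolding ratio by (intro Bochner_Integration.integrable_sum integrable_mult_right)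
  have "expectation (\<lambda>z. wealth m n \<pi> y (\<lambda>l. I l z) / (\<Prod>l\<in>{1..m}. V l (I l z))) =
      (\<Sum>\<gamma>\<in>tickets m n. y \<gamma> * expectation (\<lambda>z. \<Prod>l\<in>{1..m}. h \<gamma> l (I l z)))"
    unfolding ratio using int by (subst Bochner_Integration.integral_sum) auto
  also have "\<dots> \<le> (\<Sum>\<gamma>\<in>tickets m n. y \<gamma> * 1)"
  proof (intro sum_mono mult_left_mono)
    fix \<gamma> assume \<gamma>: "\<gamma> \<in> tickets m n"
    show "y \<gamma> \<ge> 0"
      using y \<gamma> by (simp add: multibet_feasible_def)
    have h_nonneg: "h \<gamma> l i \<ge> 0" if "l \<in> {1..m}" "i \<in> {1..n l}" for l i
      unfolding h_def using V[OF that] \<pi> ticket_entry[OF \<gamma> that(1)] that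
      by (intro divide_nonneg_pos payout_nonneg) auto
    have "expectation (\<lambda>z. \<Prod>l\<in>{1..m}. h \<gamma> l (I l z)) =
        (\<Prod>l\<in>{1..m}. \<Sum>i\<in>{1..n l}. prob {z \<in> space M. I l z = i} * h \<gamma> l i)"
      by (rule indep_vars_finite_valued_prod(2)[OF ind]) auto
    also have "\<dots> \<le> 1"
    proof (rule prod_le_1, rule conjI)
      fix l assume l: "l \<in> {1..m}"
      show "0 \<le> (\<Sum>i\<in>{1..n l}. prob {z \<in> space M. I l z = i} * h \<gamma> l i)"
        using h_nonneg[OF l] by (intro sum_nonneg mult_nonneg_nonneg) auto
      show "(\<Sum>i\<in>{1..n l}. prob {z \<in> space M. I l z = i} * h \<gamma> l i) \<le> 1"
        unfolding h_def by (rule bound[OF l ticket_entry[OF \<gamma> l]])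
    qed
    finally show "expectation (\<lambda>z. \<Prod>l\<in>{1..m}. h \<gamma> l (I l z)) \<le> 1" .
  qed
  also have "\<dots> = 1"
    using y by (simp add: multibet_feasible_def)
  finally show "expectation (\<lambda>z. wealth m n \<pi> y (\<lambda>l. I l z) / (\<Prod>l\<in>{1..m}. V l (I l z))) \<le> 1" .
qed

text \<open>Concavity: the right-hand side is the tangent line of the logarithm at \<open>u\<close>.\<close>

lemma elog_le_tangent: "u > 0 \<Longrightarrow> elog w \<le> ereal (ln u + w / u - 1)"
  using ln_diff_le[of w u] by (auto simp: elog_def diff_divide_distrib)

theorem (in prob_space) product_book_optimal:
  assumes ind: "indep_vars (\<lambda>l. count_space {1..n l}) I {1..m}"
    and p1: "\<And>l. l \<in> {1..m} \<Longrightarrow> (\<Sum>i\<in>{1..n l}. p l i) = 1"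
    and \<pi>: "\<And>l i. l \<in> {1..m} \<Longrightarrow> i \<in> {1..n l} \<Longrightarrow> \<pi> l i > 0"
    and p: "\<And>l i. l \<in> {1..m} \<Longrightarrow> i \<in> {1..n l} \<Longrightarrow> prob {z \<in> space M. I l z = i} = p l i"
    and opt: "\<And>l. l \<in> {1..m} \<Longrightarrow> kelly_optimal (n l) (p l) (\<pi> l) (c l) (s l)"
    and c: "\<And>l. l \<in> {1..m} \<Longrightarrow> c l > 0"
    and x: "\<And>\<gamma>. \<gamma> \<in> tickets m n \<Longrightarrow> x \<gamma> = product_book m c s \<gamma>"
  shows "multibet_optimal M I m n \<pi> x"
  unfolding multibet_optimal_def
proof (intro conjI allI impI)
  show "multibet_feasible m n x"
    using opt by (intro product_book_feasible[OF _ x]) (auto simp: kelly_optimal_def)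
next
  fix y assume y: "multibet_feasible m n y"
  define V where "V l i = c l + s l i / \<pi> l i" for l i
  define U where "U z = (\<Prod>l\<in>{1..m}. V l (I l z))" for z
  define R where "R z = wealth m n \<pi> y (\<lambda>l. I l z) / U z" for z
  have I: "I l \<in> measurable M (count_space {1..n l})" if "l \<in> {1..m}" for l
    using ind that by (auto simp: indep_vars_def)
  have I_range: "I l z \<in> {1..n l}" if "z \<in> space M" "l \<in> {1..m}" for l z
    using measurable_space[OF I[OF that(2)] that(1)] by simp
  have V: "V l i > 0" if "l \<in> {1..m}" "i \<in> {1..n l}" for l i
    unfolding V_def using that by (intro kelly_optimal_value_pos[OF opt c] \<pi>)
  have V_I: "V l (I l z) > 0" if "z \<in> space M" "l \<in> {1..m}" for l z
    using that by (intro V I_range)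
  have U: "U z > 0" if "z \<in> space M" for z
    unfolding U_def using that by (intro prod_pos V_I)
  have bound: "(\<Sum>i\<in>{1..n l}. prob {z \<in> space M. I l z = i} * (payout (\<pi> l) k i / V l i)) \<le> 1"
    if "l \<in> {1..m}" "k \<in> {0} \<union> {1..n l}" for l k
    using kelly_optimal_instrument_bound[OF opt[OF that(1)] _ \<pi> p1 that(2)] that V
    by (simp add: p V_def)
  have R: "integrable M R" "expectation R \<le> 1"
    unfolding R_def U_def by (rule expected_wealth_ratio_le_1[OF ind V \<pi> bound y]; assumption)+
  have ln_U: "ln (U z) = (\<Sum>l\<in>{1..m}. ln (V l (I l z)))" if "z \<in> space M" for z
    unfolding U_def
    by (rule ln_prod[OF finite_atLeastAtMost]) (use V_I[OF that] in \<open>metis less_irrefl\<close>)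
  have int_ln: "integrable M (\<lambda>z. ln (U z))"
  proof -
    have "integrable M (\<lambda>z. \<Sum>l\<in>{1..m}. ln (V l (I l z)))"
      by (intro Bochner_Integration.integrable_sum finite_valued_expectation(1)[OF I]) auto
    moreover have "integrable M (\<lambda>z. ln (U z)) \<longleftrightarrow> integrable M (\<lambda>z. \<Sum>l\<in>{1..m}. ln (V l (I l z)))"
      by (rule Bochner_Integration.integrable_cong[OF refl ln_U])
    ultimately show ?thesis by blast
  qed
  have "multibet_objective M I m n \<pi> y \<le> ext_expectation M (\<lambda>z. ereal (ln (U z) + R z - 1))"
    unfolding multibet_objective_def R_def by (intro ext_expectation_mono elog_le_tangent U)
  also have "\<dots> = ereal (expectation (\<lambda>z. ln (U z) + R z - 1))"
    using int_ln R(1) by (intro ext_expectation_ereal) auto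
  also have "expectation (\<lambda>z. ln (U z) + R z - 1) = expectation (\<lambda>z. ln (U z)) + expectation R - 1"
    using int_ln R(1) by (simp add: prob_space)
  also have "ereal \<dots> \<le> ereal (expectation (\<lambda>z. ln (U z)))"
    using R(2) by simp
  also have "\<dots> = ext_expectation M (\<lambda>z. ereal (ln (U z)))"
    by (rule ext_expectation_ereal[OF int_ln, symmetric])
  also have "\<dots> = multibet_objective M I m n \<pi> x"
    unfolding multibet_objective_def
  proof (rule ext_expectation_cong)
    fix z assume z: "z \<in> space M"
    have "wealth m n \<pi> x (\<lambda>l. I l z) = U z"
      unfolding U_def V_def using I_range[OF z] by (intro wealth_product_book x)
    then show "ereal (ln (U z)) = elog (wealth m n \<pi> x (\<lambda>l. I l z))"
      using U[OF z] by (simp add: elog_def)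
  qed
  finally show "multibet_objective M I m n \<pi> y \<le> multibet_objective M I m n \<pi> x" .
qed

theorem corollary3p2:
  fixes m :: nat and n :: "nat \<Rightarrow> nat"
    and p \<pi> s :: "nat \<Rightarrow> nat \<Rightarrow> real" and c :: "nat \<Rightarrow> real"
    and x :: "(nat \<Rightarrow> nat) \<Rightarrow> real"
    and M :: "'a measure" and I :: "nat \<Rightarrow> 'a \<Rightarrow> nat"
  assumes "m \<ge> 1"
    and "\<And>l i. l \<in> {1..m} \<Longrightarrow> i \<in> {1..n l} \<Longrightarrow> p l i > 0"
    and "\<And>l. l \<in> {1..m} \<Longrightarrow> (\<Sum>i\<in>{1..n l}. p l i) = 1"
    and "\<And>l i. l \<in> {1..m} \<Longrightarrow> i \<in> {1..n l} \<Longrightarrow> \<pi> l i > 0"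
    and "prob_space M"
    and "prob_space.indep_vars M (\<lambda>l. count_space {1..n l}) I {1..m}"
    and "\<And>l i. l \<in> {1..m} \<Longrightarrow> i \<in> {1..n l} \<Longrightarrow>
           measure M {z \<in> space M. I l z = i} = p l i"
    and "\<And>l. l \<in> {1..m} \<Longrightarrow> kelly_unique_optimal (n l) (p l) (\<pi> l) (c l) (s l)"
    and "\<And>l. l \<in> {1..m} \<Longrightarrow> c l > 0"
    and "\<And>\<gamma>. \<gamma> \<in> tickets m n \<Longrightarrow> x \<gamma> = product_book m c s \<gamma>"
  shows "multibet_optimal M I m n \<pi> x \<and>
    (\<forall>\<gamma>\<in>tickets m n.
           ticket_active x \<gamma> \<longleftrightarrow> (\<forall>l\<in>selected m \<gamma>. outcome_active (s l) (\<gamma> l))) \<and>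
    (\<forall>\<gamma>\<in>tickets m n. ticket_active x \<gamma> \<longrightarrow> \<not> (\<exists>l\<in>selected m \<gamma>. s l (\<gamma> l) = 0))"
proof -
  interpret prob_space M by fact
  have opt: "kelly_optimal (n l) (p l) (\<pi> l) (c l) (s l)" if "l \<in> {1..m}" for l
    using assms(8)[OF that] by (simp add: kelly_unique_optimal_def)
  then have feas: "kelly_feasible (n l) (c l) (s l)" if "l \<in> {1..m}" for l
    using that by (simp add: kelly_optimal_def)
  have "multibet_optimal M I m n \<pi> x"
    by (rule product_book_optimal[OF assms(6,3,4,7) opt assms(9,10)])
  moreover have active: "ticket_active x \<gamma> \<longleftrightarrow> (\<forall>l\<in>selected m \<gamma>. outcome_active (s l) (\<gamma> l))"
    if "\<gamma> \<in> tickets m n" for \<gamma>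
    using product_book_pos_iff[OF feas assms(9) that]
    by (simp add: ticket_active_def outcome_active_def assms(10)[OF that])
  moreover have "\<not> (\<exists>l\<in>selected m \<gamma>. s l (\<gamma> l) = 0)"
    if "\<gamma> \<in> tickets m n" "ticket_active x \<gamma>" for \<gamma>
    using active[OF that(1)] that(2) by (force simp: outcome_active_def)
  ultimately show ?thesis by blast
qed

end
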